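(* Let $\mathcal G=(\mathcal V,\mathcal E)$ be a finite undirected graph, let $\mathscr S$ be the family of all its maximal stable sets, and let $\tau\in\mathbb Z_{\ge 0}$ be a target value. Let $\bm\Pi=\bm\Pi_F\cup\bm\Pi_I=\{\boldsymbol\pi_1,\boldsymbol\pi_2,\ldots,\boldsymbol\pi_q\}\subseteq\mathbb R^{|\mathcal V|}_{\ge 0}$ be a finite set of vectors, where every vector in $\bm\Pi_F$ is dual feasible and every vector $\boldsymbol\pi\in\bm\Pi_I$ satisfies $rc^*(\boldsymbol\pi)<0$. Write $\pi_{h,v}$ for the component of $\boldsymbol\pi_h$ associated with vertex $v$, and for $h\in\{1,\ldots,q\}$ let $$\delta_h:=\begin{cases}\tau-\sum_{v\in\mathcal V}\pi_{h,v}, & \boldsymbol\pi_h\in\bm\Pi_F,\\ \tau-\sum_{v\in\mathcal V}\pi_{h,v}-(\tau-1)\,rc^*(\boldsymbol\pi_h), & \boldsymbol\pi_h\in\bm\Pi_I.\end{cases}$$ Let $\bar{\mathcal S}\subseteq\mathcal V$ be a (partial) stable set, let $\mathcal C\subseteq\mathcal V$, and let $\mathscr B\subseteq\mathscr S$ be a family of maximal stable sets (those generated below the current branch of an enumeration) such that every $\hat{\mathcal S}\in\mathscr B$ satisfies $\bar{\mathcal S}\subseteq\hat{\mathcal S}\subseteq\bar{\mathcal S}\cup\mathcal C$. If there exists $h\in\{1,2,\ldots,q\}$ such that $$1-\sum_{v\in\bar{\mathcal S}\cup\mathcal C}\pi_{h,v}>\delta_h,$$ then for every $\hat{\mathcal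 S}\in\mathscr B$, no feasible integer solution $\boldsymbol\xi$ of the set-covering formulation with objective value at most $\tau$ satisfies $\xi_{\hat{\mathcal S}}=1$.
   Context: A stable set of $\mathcal G$ is a set of pairwise nonadjacent vertices; a maximal stable set is an inclusion-wise maximal stable set. For $v\in\mathcal V$, $\mathscr S(v)\subseteq\mathscr S$ denotes the maximal stable sets containing $v$. Set-covering formulation of graph coloring: $$\min_{\boldsymbol\xi\in\{0,1\}^{\mathscr S}}\Big\{\sum_{\mathcal S\in\mathscr S}\xi_{\mathcal S}:\ \sum_{\mathcal S\in\mathscr S(v)}\xi_{\mathcal S}\ge 1\ \text{ for all } v\in\mathcal V\Big\}.$$ A feasible integer solution is a vector $\boldsymbol\xi\in\{0,1\}^{\mathscr S}$ satisfying all these covering constraints; its objective value is $\sum_{\mathcal S\in\mathscr S}\xi_{\mathcal S}$. A vector $\boldsymbol\pi\in\mathbb R^{|\mathcal V|}_{\ge 0}$ is dual feasible (for the master problem, i.e. the LP relaxation of the set-covering formulation with nonnegative variables) if $\sum_{v\in\mathcal S}\pi_v\le 1$ for all $\mathcal S\in\mathscr S$. The reduced cost of $\mathcal S\in\mathscr S$ with respect to $\boldsymbol\pi\in\mathbb R^{|\mathcal V|}_{\ge 0}$ is $rc(\mathcal S,\boldsymbol\pi):=1-\sum_{v\in\mathcal S}\pi_v$, and $rc^*(\boldsymbol\pi):=\min_{\mathcal S\in\mathscr S}rc(\mathcal S,\boldsymbol\pi)$. *)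

theory Defs
  imports Complex_Main "HOL-Library.FuncSet"
begin

text \<open>
  Edges are unordered pairs of vertices. Loops \<open>{u}\<close> are permitted but play no role, because
  stability only constrains pairs of distinct vertices; simple graphs are a special case.
\<close>

definition ugraph :: "'a set \<Rightarrow> 'a set set \<Rightarrow> bool" where
  "ugraph V E \<longleftrightarrow> finite V \<and> (\<forall>e\<in>E. \<exists>u\<in>V. \<exists>v\<in>V. e = {u, v})"

definition stable_set :: "'a set \<Rightarrow> 'a set set \<Rightarrow> 'a set \<Rightarrow> bool" where
  "stable_set V E S \<longleftrightarrow> S \<subseteq> V \<and> pairwise (\<lambda>u v. {u, v} \<notin> E) S"

definition max_stable_sets :: "'a set \<Rightarrow> 'a set set \<Rightarrow> 'a set set" where
  "max_stable_sets V E = {S. stable_set V E S \<and> (\<forall>T. stable_set V E T \<and> S \<subseteq> T \<longrightarrow> T = S)}"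

definition max_stable_sets_at :: "'a set \<Rightarrow> 'a set set \<Rightarrow> 'a \<Rightarrow> 'a set set" where
  "max_stable_sets_at V E v = {S \<in> max_stable_sets V E. v \<in> S}"

text \<open>
  A vector indexed by a set \<open>I\<close> is an extensional function on \<open>I\<close>, so that a set of vectors does
  not distinguish functions that agree on \<open>I\<close>.
\<close>

definition feasible_integer_solution ::
    "'a set \<Rightarrow> 'a set set \<Rightarrow> ('a set \<Rightarrow> real) \<Rightarrow> bool" where
  "feasible_integer_solution V E \<xi> \<longleftrightarrow>
     \<xi> \<in> max_stable_sets V E \<rightarrow>\<^sub>E {0, 1} \<and>
     (\<forall>v\<in>V. (\<Sum>S\<in>max_stable_sets_at V E v. \<xi> S) \<ge> 1)"

definition objective_value :: "'a set \<Rightarrow> 'a set set \<Rightarrow> ('a set \<Rightarrow> real) \<Rightarrow> real" where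
  "objective_value V E \<xi> = (\<Sum>S\<in>max_stable_sets V E. \<xi> S)"

definition nonneg_vectors :: "'a set \<Rightarrow> ('a \<Rightarrow> real) set" where
  "nonneg_vectors V = V \<rightarrow>\<^sub>E {0..}"

definition dual_feasible :: "'a set \<Rightarrow> 'a set set \<Rightarrow> ('a \<Rightarrow> real) \<Rightarrow> bool" where
  "dual_feasible V E \<pi> \<longleftrightarrow>
     \<pi> \<in> nonneg_vectors V \<and> (\<forall>S\<in>max_stable_sets V E. (\<Sum>v\<in>S. \<pi> v) \<le> 1)"

definition reduced_cost :: "('a \<Rightarrow> real) \<Rightarrow> 'a set \<Rightarrow> real" where
  "reduced_cost \<pi> S = 1 - (\<Sum>v\<in>S. \<pi> v)"

definition min_reduced_cost :: "'a set \<Rightarrow> 'a set set \<Rightarrow> ('a \<Rightarrow> real) \<Rightarrow> real" where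
  "min_reduced_cost V E \<pi> = Min (reduced_cost \<pi> ` max_stable_sets V E)"

text \<open>The minimum above ranges over a finite nonempty set.\<close>

lemma finite_max_stable_sets:
  assumes "ugraph V E"
  shows "finite (max_stable_sets V E)"
proof (rule finite_subset)
  show "max_stable_sets V E \<subseteq> Pow V"
    by (auto simp: max_stable_sets_def stable_set_def)
  show "finite (Pow V)"
    using assms by (simp add: ugraph_def)
qed

lemma max_stable_sets_nonempty:
  assumes "ugraph V E"
  shows "max_stable_sets V E \<noteq> {}"
proof -
  let ?F = "{S. stable_set V E S}"
  have "?F \<subseteq> Pow V"
    by (auto simp: stable_set_def)
  then have "finite ?F"
    using assms by (meson finite_Pow_iff finite_subset ugraph_def)
  moreover have "{} \<in> ?F"
    by (simp add: stable_set_def)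
  ultimately obtain S where "S \<in> ?F" "\<forall>T\<in>?F. S \<subseteq> T \<longrightarrow> S = T"
    using finite_has_maximal[of ?F] by blast
  then have "S \<in> max_stable_sets V E"
    by (auto simp: max_stable_sets_def)
  then show ?thesis
    by blast
qed

text \<open>
  The argument \<open>\<pi>\<close> is meant to lie in \<open>\<Pi>F\<close> or in the set of vectors of negative minimum reduced
  cost. These are disjoint: a dual feasible vector has nonnegative minimum reduced cost.
\<close>

definition delta ::
    "'a set \<Rightarrow> 'a set set \<Rightarrow> nat \<Rightarrow> ('a \<Rightarrow> real) set \<Rightarrow> ('a \<Rightarrow> real) \<Rightarrow> real" where
  "delta V E \<tau> \<Pi>F \<pi> =
     (if \<pi> \<in> \<Pi>F then real \<tau> - (\<Sum>v\<in>V. \<pi> v)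
      else real \<tau> - (\<Sum>v\<in>V. \<pi> v) - (real \<tau> - 1) * min_reduced_cost V E \<pi>)"

end

theory Submission
  imports Defs
begin

text \<open>
  Weighting the covering constraints by \<open>\<pi>\<close> and exchanging sums gives
  \<open>(\<Sum>v\<in>V. \<pi> v) \<le> (\<Sum>S. \<xi> S * (1 - rc(S, \<pi>)))\<close>. If \<open>m \<le> 0\<close> bounds all reduced costs from below,
  bounding every chosen set other than \<open>T\<close> by \<open>m\<close> shows that a solution of value at most \<open>\<tau>\<close>
  can use \<open>T\<close> only if \<open>rc(T, \<pi>) \<le> \<tau> - (\<Sum>v\<in>V. \<pi> v) - (\<tau> - 1) * m\<close>. Dual feasible vectors are the case
  \<open>m = 0\<close>, the others the case \<open>m = rc\<^sup>*(\<pi>)\<close>. Since \<open>\<pi>\<close> is nonnegative,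
  \<open>1 - (\<Sum>v\<in>Sbar \<union> C. \<pi> v)\<close> is a lower bound for \<open>rc(T, \<pi>)\<close>.
\<close>

lemma sum_le_weighted_reduced_costs:
  assumes G: "ugraph V E"
    and p: "p \<in> nonneg_vectors V"
    and feas: "feasible_integer_solution V E \<xi>"
  shows "(\<Sum>v\<in>V. p v) \<le> (\<Sum>S\<in>max_stable_sets V E. \<xi> S * (1 - reduced_cost p S))"
proof -
  let ?M = "max_stable_sets V E"
  have finV: "finite V" using G by (simp add: ugraph_def)
  have finM: "finite ?M" by (rule finite_max_stable_sets[OF G])
  have "(\<Sum>v\<in>V. p v) \<le> (\<Sum>v\<in>V. p v * (\<Sum>S\<in>max_stable_sets_at V E v. \<xi> S))"
  proof (rule sum_mono)
    fix v assume "v \<in> V"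
    then have "0 \<le> p v" "1 \<le> (\<Sum>S\<in>max_stable_sets_at V E v. \<xi> S)"
      using p feas by (auto simp: nonneg_vectors_def feasible_integer_solution_def)
    then show "p v \<le> p v * (\<Sum>S\<in>max_stable_sets_at V E v. \<xi> S)"
      using mult_left_mono[of 1 _ "p v"] by simp
  qed
  also have "\<dots> = (\<Sum>v\<in>V. \<Sum>S | S \<in> ?M \<and> v \<in> S. \<xi> S * p v)"
    by (simp add: max_stable_sets_at_def sum_distrib_left mult.commute)
  \<comment> \<open>Double counting of the pairs with \<open>v \<in> S\<close>: regrouped by
    \<open>S\<close>, the inner sum is the \<open>p\<close>-weight of \<open>S\<close> scaled by
    \<open>\<xi> S\<close>.\<close>
  also have "\<dots> = (\<Sum>S\<in>?M. \<Sum>v | v \<in> V \<and> v \<in> S. \<xi> S * p v)"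
    by (rule sum.swap_restrict[OF finV finM])
  also have "\<dots> = (\<Sum>S\<in>?M. \<xi> S * (1 - reduced_cost p S))"
  proof (rule sum.cong[OF refl])
    fix S assume "S \<in> ?M"
    then have "{v. v \<in> V \<and> v \<in> S} = S"
      by (auto simp: max_stable_sets_def stable_set_def)
    then show "(\<Sum>v | v \<in> V \<and> v \<in> S. \<xi> S * p v) = \<xi> S * (1 - reduced_cost p S)"
      by (simp add: reduced_cost_def sum_distrib_left)
  qed
  finally show ?thesis .
qed

text \<open>The bound \<open>m\<close> stays a parameter so that one estimate serves both branches
  of \<open>delta\<close>. \<open>T\<close> is split off with its exact reduced cost; the other
  chosen sets have total weight at most \<open>t - 1\<close>, and each unit of weight contributes at
  most \<open>1 - m\<close>.\<close>

lemma reduced_cost_le_of_selected: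
  assumes G: "ugraph V E"
    and p: "p \<in> nonneg_vectors V"
    and feas: "feasible_integer_solution V E \<xi>"
    and obj: "objective_value V E \<xi> \<le> t"
    and T: "T \<in> max_stable_sets V E" "\<xi> T = 1"
    and m: "m \<le> 0" "\<And>S. S \<in> max_stable_sets V E \<Longrightarrow> m \<le> reduced_cost p S"
  shows "reduced_cost p T \<le> t - (\<Sum>v\<in>V. p v) - (t - 1) * m"
proof -
  let ?M = "max_stable_sets V E"
  let ?obj = "objective_value V E \<xi>"
  have finM: "finite ?M" by (rule finite_max_stable_sets[OF G])
  have nonneg: "0 \<le> \<xi> S" if "S \<in> ?M" for S
    using feas that by (auto simp: feasible_integer_solution_def dest!: PiE_mem)
  have "(\<Sum>v\<in>V. p v) \<le> (\<Sum>S\<in>?M. \<xi> S * (1 - reduced_cost p S))"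
    by (rule sum_le_weighted_reduced_costs[OF G p feas])
  also have "\<dots> = (1 - reduced_cost p T) + (\<Sum>S\<in>?M - {T}. \<xi> S * (1 - reduced_cost p S))"
    using T by (simp add: sum.remove[OF finM])
  also have "(\<Sum>S\<in>?M - {T}. \<xi> S * (1 - reduced_cost p S)) \<le> (\<Sum>S\<in>?M - {T}. \<xi> S * (1 - m))"
    using nonneg m by (intro sum_mono mult_left_mono) auto
  also have "\<dots> = (?obj - 1) * (1 - m)"
    using T by (simp add: objective_value_def sum.remove[OF finM] flip: sum_distrib_right)
  \<comment> \<open>The sign of \<open>m\<close> enters here: \<open>1 - m\<close> is nonnegative,
    so the factor \<open>?obj - 1\<close> may be raised to \<open>t - 1\<close>.\<close>
  also have "\<dots> \<le> (t - 1) * (1 - m)"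
    using obj m by (intro mult_right_mono) auto
  finally show ?thesis
    by (simp add: algebra_simps)
qed

theorem theorem1:
  fixes V :: "'a set" and E :: "'a set set" and \<tau> q :: nat
    and \<Pi>F \<Pi>I :: "('a \<Rightarrow> real) set" and \<pi> :: "nat \<Rightarrow> 'a \<Rightarrow> real"
    and Sbar C :: "'a set" and B :: "'a set set"
  assumes "ugraph V E"
    and "\<Pi>F \<union> \<Pi>I = \<pi> ` {1..q}"
    and "\<Pi>F \<union> \<Pi>I \<subseteq> nonneg_vectors V"
    and "\<forall>p\<in>\<Pi>F. dual_feasible V E p"
    and "\<forall>p\<in>\<Pi>I. min_reduced_cost V E p < 0"
    and "stable_set V E Sbar"
    and "C \<subseteq> V"
    and "B \<subseteq> max_stable_sets V E"
    and "\<forall>S\<in>B. Sbar \<subseteq> S \<and> S \<subseteq> Sbar \<union> C"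
    and "\<exists>h\<in>{1..q}. 1 - (\<Sum>v\<in>Sbar \<union> C. \<pi> h v) > delta V E \<tau> \<Pi>F (\<pi> h)"
  shows "\<forall>S\<in>B. \<not> (\<exists>\<xi>. feasible_integer_solution V E \<xi> \<and>
           objective_value V E \<xi> \<le> real \<tau> \<and> \<xi> S = 1)"
proof
  fix S assume "S \<in> B"
  then have S: "S \<in> max_stable_sets V E" "S \<subseteq> Sbar \<union> C"
    using assms(8,9) by auto
  obtain h where h: "h \<in> {1..q}" "1 - (\<Sum>v\<in>Sbar \<union> C. \<pi> h v) > delta V E \<tau> \<Pi>F (\<pi> h)"
    using assms(10) by blast
  have mem: "\<pi> h \<in> \<Pi>F \<union> \<Pi>I"
    using assms(2) h(1) by blast
  then have p: "\<pi> h \<in> nonneg_vectors V"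
    using assms(3) by blast
  have sub: "Sbar \<union> C \<subseteq> V"
    using assms(6,7) by (auto simp: stable_set_def)
  then have "finite (Sbar \<union> C)"
    using assms(1) finite_subset by (auto simp: ugraph_def)
  then have "(\<Sum>v\<in>S. \<pi> h v) \<le> (\<Sum>v\<in>Sbar \<union> C. \<pi> h v)"
    using S(2) sub p by (intro sum_mono2) (auto simp: nonneg_vectors_def dest!: PiE_mem)
  then have above: "delta V E \<tau> \<Pi>F (\<pi> h) < reduced_cost (\<pi> h) S"
    using h(2) by (simp add: reduced_cost_def)
  show "\<not> (\<exists>\<xi>. feasible_integer_solution V E \<xi> \<and>
           objective_value V E \<xi> \<le> real \<tau> \<and> \<xi> S = 1)"
  proof
    assume "\<exists>\<xi>. feasible_integer_solution V E \<xi> \<and> objective_value V E \<xi> \<le> real \<tau> \<and> \<xi> S = 1"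
    then obtain \<xi> where xi: "feasible_integer_solution V E \<xi>"
      "objective_value V E \<xi> \<le> real \<tau>" "\<xi> S = 1"
      by blast
    note bound = reduced_cost_le_of_selected[OF assms(1) p xi(1,2) S(1) xi(3)]
    have "reduced_cost (\<pi> h) S \<le> delta V E \<tau> \<Pi>F (\<pi> h)"
    proof (cases "\<pi> h \<in> \<Pi>F")
      case True
      \<comment> \<open>Dual feasibility makes \<open>m = 0\<close> admissible, and the term
        \<open>(t - 1) * m\<close> then vanishes.\<close>
      then have "0 \<le> reduced_cost (\<pi> h) T" if "T \<in> max_stable_sets V E" for T
        using assms(4) that by (auto simp: dual_feasible_def reduced_cost_def)
      with bound[of 0] True show ?thesis
        by (simp add: delta_def)
    next
      case False
      \<comment> \<open>Outside \<open>\<Pi>F\<close>, \<open>mem\<close> places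
        \<open>\<pi> h\<close> in \<open>\<Pi>I\<close>, so the else branch of \<open>delta\<close>
        involves a negative minimum.\<close>
      then have "min_reduced_cost V E (\<pi> h) < 0"
        using assms(5) mem by blast
      moreover have "min_reduced_cost V E (\<pi> h) \<le> reduced_cost (\<pi> h) T"
        if "T \<in> max_stable_sets V E" for T
        using that finite_max_stable_sets[OF assms(1)] by (simp add: min_reduced_cost_def)
      ultimately show ?thesis
        using bound[of "min_reduced_cost V E (\<pi> h)"] False by (simp add: delta_def)
    qed
    with above show False by simp
  qed
qed

end
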